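(* Let $k$ be a field, $H$ a Hopf algebra over $k$ with antipode $S$, $C$ a right $H$-module coalgebra, and $M$ a relative $[C,H]$-Hopf module. Suppose there is a right $H$-module coalgebra map $\phi:C\to H$, where $H$ is a right $H$-module coalgebra via its multiplication. Define $E_C:C\to C$ and $E_M:M\to M$ by $$E_C(c)=c_1\cdot S\phi(c_2),\qquad E_M(m)=m_{[0]}\cdot S\phi(m_{[1]}),$$ for $c\in C$, $m\in M$. Then $(M,E_C,E_M)$ is a Rota-Baxter paired right $C$-comodule of weight $-1$.
   Context: All spaces, maps and tensor products are over $k$; $\Delta(c)=c_1\otimes c_2$, and right coactions are written $\rho(m)=m_{[0]}\otimes m_{[1]}\in M\otimes C$. A right $H$-module coalgebra is a coalgebra $C$ that is a right $H$-module with $\Delta(c\cdot h)=c_1\cdot h_1\otimes c_2\cdot h_2$ and $\varepsilon(c\cdot h)=\varepsilon(c)\varepsilon(h)$; a map of right $H$-module coalgebras is an $H$-linear coalgebra map. A relative $[C,H]$-Hopf module is a right $C$-comodule $M$ that is also a right $H$-module with $\rho(m\cdot h)=m_{[0]}\cdot h_1\otimes m_{[1]}\cdot h_2$ for all $m\in M$, $h\in H$. For a right $C$-comodule $M$ and linear maps $P:C\to C$, $T:M\to M$, the triple $(M,P,T)$ is a Rota-Baxter paired right $C$-comodule of weight $\lambda\in k$ if $(T\otimes P)\rho=(\mathrm{id}\otimes P)\rho T+(T\otimes\mathrm{id})\rho T+\lambda\rho T$. *)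

theory Defs
  imports Complex_Main "HOL-Library.Poly_Mapping"
begin

text \<open>
  A vector space over the field \<open>'k\<close> is a type \<open>'v\<close> with a scalar multiplication satisfying the
  library locale \<^locale>\<open>vector_space\<close>.  The tensor product \<open>V \<otimes> W\<close> is the free vector space on
  \<open>V \<times> W\<close> modulo the bilinearity relations; its elements are cosets of formal sums.
\<close>

section \<open>Free vector spaces and their quotients\<close>

definition fscale :: "'k::field \<Rightarrow> ('x \<Rightarrow>\<^sub>0 'k) \<Rightarrow> ('x \<Rightarrow>\<^sub>0 'k)" where
  "fscale r p = Poly_Mapping.map ((*) r) p"

text \<open>The linear extension to the free vector space of a function on its basis.\<close>

definition lin_ext :: "('k::field \<Rightarrow> 'v::ab_group_add \<Rightarrow> 'v) \<Rightarrow> ('x \<Rightarrow> 'v) \<Rightarrow> ('x \<Rightarrow>\<^sub>0 'k) \<Rightarrow> 'v" where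
  "lin_ext s f p = (\<Sum>x\<in>Poly_Mapping.keys p. s (Poly_Mapping.lookup p x) (f x))"

definition coset :: "'v::ab_group_add set \<Rightarrow> 'v \<Rightarrow> 'v set" where
  "coset N p = {q. q - p \<in> N}"

definition qspace :: "'v::ab_group_add set \<Rightarrow> 'v set set" where
  "qspace N = range (coset N)"

definition qadd :: "'v::ab_group_add set \<Rightarrow> 'v set \<Rightarrow> 'v set \<Rightarrow> 'v set" where
  "qadd N X Y = (\<Union>p\<in>X. \<Union>q\<in>Y. coset N (p + q))"

definition qscale :: "('x \<Rightarrow>\<^sub>0 'k::field) set \<Rightarrow> 'k \<Rightarrow> ('x \<Rightarrow>\<^sub>0 'k) set \<Rightarrow> ('x \<Rightarrow>\<^sub>0 'k) set" where
  "qscale N r X = (\<Union>p\<in>X. coset N (fscale r p))"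

text \<open>
  \<open>qlift N F\<close> and \<open>vlift s f\<close> are the linear maps out of a quotient of the free vector space that
  send the class of a basis element \<open>x\<close> to \<open>F x\<close> (a coset of \<open>N\<close>) and to the vector \<open>f x\<close>,
  respectively.  They are meaningful when \<open>F\<close> or \<open>f\<close> respects the relations of the source
  quotient, for example when it is bilinear and the source is a tensor product.
  Applied to \<open>\<Delta> c\<close>, they render Sweedler notation: \<open>vlift s (\<lambda>(a, b). f a b) (\<Delta> c)\<close> is \<open>f c\<^sub>1 c\<^sub>2\<close>.
\<close>

definition qlift ::
    "('y \<Rightarrow>\<^sub>0 'k::field) set \<Rightarrow> ('x \<Rightarrow> ('y \<Rightarrow>\<^sub>0 'k) set) \<Rightarrow> ('x \<Rightarrow>\<^sub>0 'k) set \<Rightarrow> ('y \<Rightarrow>\<^sub>0 'k) set" where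
  "qlift N F X = (\<Union>p\<in>X. \<Union>f\<in>{f. \<forall>x. f x \<in> F x}. coset N (lin_ext fscale f p))"

definition vlift ::
    "('k::field \<Rightarrow> 'v::ab_group_add \<Rightarrow> 'v) \<Rightarrow> ('x \<Rightarrow> 'v) \<Rightarrow> ('x \<Rightarrow>\<^sub>0 'k) set \<Rightarrow> 'v" where
  "vlift s f X = the_elem (lin_ext s f ` X)"

definition linear_to_quotient ::
    "('k::field \<Rightarrow> 'v::ab_group_add \<Rightarrow> 'v) \<Rightarrow> ('x \<Rightarrow>\<^sub>0 'k) set \<Rightarrow> ('v \<Rightarrow> ('x \<Rightarrow>\<^sub>0 'k) set) \<Rightarrow> bool" where
  "linear_to_quotient s N F \<longleftrightarrow>
     (\<forall>v. F v \<in> qspace N) \<and>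
     (\<forall>v w. F (v + w) = qadd N (F v) (F w)) \<and>
     (\<forall>r v. F (s r v) = qscale N r (F v))"

section \<open>Tensor products\<close>

type_synonym ('a, 'b, 'k) tensor = "('a \<times> 'b \<Rightarrow>\<^sub>0 'k) set"

text \<open>The relations saying that the basis element \<open>i a\<close> depends linearly on \<open>a\<close>.\<close>

definition slot_rel ::
    "('k::field \<Rightarrow> 'a::ab_group_add \<Rightarrow> 'a) \<Rightarrow> ('a \<Rightarrow> 'x) \<Rightarrow> ('x \<Rightarrow>\<^sub>0 'k) set" where
  "slot_rel s i =
     {Poly_Mapping.single (i (a + a')) 1 - Poly_Mapping.single (i a) 1 - Poly_Mapping.single (i a') 1
       | a a'. True} \<union>
     {Poly_Mapping.single (i (s r a)) 1 - fscale r (Poly_Mapping.single (i a) 1) | r a. True}"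

definition tensor_rel ::
    "('k::field \<Rightarrow> 'a::ab_group_add \<Rightarrow> 'a) \<Rightarrow> ('k \<Rightarrow> 'b::ab_group_add \<Rightarrow> 'b) \<Rightarrow> ('a \<times> 'b \<Rightarrow>\<^sub>0 'k) set" where
  "tensor_rel sA sB = module.span fscale
     ((\<Union>b. slot_rel sA (\<lambda>a. (a, b))) \<union> (\<Union>a. slot_rel sB (\<lambda>b. (a, b))))"

definition tensor3_rel ::
    "('k::field \<Rightarrow> 'a::ab_group_add \<Rightarrow> 'a) \<Rightarrow> ('k \<Rightarrow> 'b::ab_group_add \<Rightarrow> 'b) \<Rightarrow>
     ('k \<Rightarrow> 'c::ab_group_add \<Rightarrow> 'c) \<Rightarrow> ('a \<times> 'b \<times> 'c \<Rightarrow>\<^sub>0 'k) set" where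
  "tensor3_rel sA sB sC = module.span fscale
     ((\<Union>b c. slot_rel sA (\<lambda>a. (a, b, c))) \<union> (\<Union>a c. slot_rel sB (\<lambda>b. (a, b, c))) \<union>
      (\<Union>a b. slot_rel sC (\<lambda>c. (a, b, c))))"

definition tens ::
    "('k::field \<Rightarrow> 'a::ab_group_add \<Rightarrow> 'a) \<Rightarrow> ('k \<Rightarrow> 'b::ab_group_add \<Rightarrow> 'b) \<Rightarrow>
     'a \<Rightarrow> 'b \<Rightarrow> ('a, 'b, 'k) tensor" where
  "tens sA sB a b = coset (tensor_rel sA sB) (Poly_Mapping.single (a, b) 1)"

definition tens3 ::
    "('k::field \<Rightarrow> 'a::ab_group_add \<Rightarrow> 'a) \<Rightarrow> ('k \<Rightarrow> 'b::ab_group_add \<Rightarrow> 'b) \<Rightarrow>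
     ('k \<Rightarrow> 'c::ab_group_add \<Rightarrow> 'c) \<Rightarrow> 'a \<Rightarrow> 'b \<Rightarrow> 'c \<Rightarrow> ('a \<times> 'b \<times> 'c \<Rightarrow>\<^sub>0 'k) set" where
  "tens3 sA sB sC a b c = coset (tensor3_rel sA sB sC) (Poly_Mapping.single (a, b, c) 1)"

text \<open>\<open>f \<otimes> g\<close>; the two scalar multiplications are those of the codomains of \<open>f\<close> and \<open>g\<close>.\<close>

definition tensor_map ::
    "('k::field \<Rightarrow> 'c::ab_group_add \<Rightarrow> 'c) \<Rightarrow> ('k \<Rightarrow> 'd::ab_group_add \<Rightarrow> 'd) \<Rightarrow>
     ('a \<Rightarrow> 'c) \<Rightarrow> ('b \<Rightarrow> 'd) \<Rightarrow> ('a, 'b, 'k) tensor \<Rightarrow> ('c, 'd, 'k) tensor" where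
  "tensor_map sC sD f g = qlift (tensor_rel sC sD) (\<lambda>(a, b). tens sC sD (f a) (g b))"

section \<open>Coalgebras, comodules and Hopf algebras\<close>

locale coalgebra = vector_space s
  for s :: "'k::field \<Rightarrow> 'c::ab_group_add \<Rightarrow> 'c" +
  fixes \<Delta> :: "'c \<Rightarrow> ('c, 'c, 'k) tensor" and \<epsilon> :: "'c \<Rightarrow> 'k"
  assumes comult_linear: "linear_to_quotient s (tensor_rel s s) \<Delta>"
    and counit_linear: "Vector_Spaces.linear s (*) \<epsilon>"
    and coassoc:
      "qlift (tensor3_rel s s s)
         (\<lambda>(a, b). qlift (tensor3_rel s s s) (\<lambda>(x, y). tens3 s s s x y b) (\<Delta> a)) (\<Delta> c) =
       qlift (tensor3_rel s s s)
         (\<lambda>(a, b). qlift (tensor3_rel s s s) (\<lambda>(x, y). tens3 s s s a x y) (\<Delta> b)) (\<Delta> c)"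
    and counit_left: "vlift s (\<lambda>(a, b). s (\<epsilon> a) b) (\<Delta> c) = c"
    and counit_right: "vlift s (\<lambda>(a, b). s (\<epsilon> b) a) (\<Delta> c) = c"

locale right_comodule =
  coalgebra sC \<Delta> \<epsilon> + M: vector_space sM
  for sC :: "'k::field \<Rightarrow> 'c::ab_group_add \<Rightarrow> 'c"
    and \<Delta> :: "'c \<Rightarrow> ('c, 'c, 'k) tensor" and \<epsilon> :: "'c \<Rightarrow> 'k"
    and sM :: "'k \<Rightarrow> 'm::ab_group_add \<Rightarrow> 'm" +
  fixes \<rho> :: "'m \<Rightarrow> ('m, 'c, 'k) tensor"
  assumes coaction_linear: "linear_to_quotient sM (tensor_rel sM sC) \<rho>"
    and coaction_coassoc:
      "qlift (tensor3_rel sM sC sC)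
         (\<lambda>(a, b). qlift (tensor3_rel sM sC sC) (\<lambda>(x, y). tens3 sM sC sC x y b) (\<rho> a)) (\<rho> m) =
       qlift (tensor3_rel sM sC sC)
         (\<lambda>(a, b). qlift (tensor3_rel sM sC sC) (\<lambda>(x, y). tens3 sM sC sC a x y) (\<Delta> b)) (\<rho> m)"
    and coaction_counit: "vlift sM (\<lambda>(a, b). sM (\<epsilon> b) a) (\<rho> m) = m"

text \<open>
  Multiplication and unit of an algebra come from the class \<^class>\<open>ring_1\<close>.  Its axiom \<open>0 \<noteq> 1\<close>
  costs no generality for bialgebras, where \<open>\<epsilon> 1 = 1\<close> already excludes the zero algebra.
\<close>

locale unital_algebra = vector_space s
  for s :: "'k::field \<Rightarrow> 'h::ring_1 \<Rightarrow> 'h" +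
  assumes scale_mult_left: "s r x * y = s r (x * y)"
    and scale_mult_right: "x * s r y = s r (x * y)"

locale bialgebra = unital_algebra s + coalgebra s \<Delta> \<epsilon>
  for s :: "'k::field \<Rightarrow> 'h::ring_1 \<Rightarrow> 'h"
    and \<Delta> :: "'h \<Rightarrow> ('h, 'h, 'k) tensor" and \<epsilon> :: "'h \<Rightarrow> 'k" +
  assumes comult_mult:
      "\<Delta> (g * h) = qlift (tensor_rel s s)
         (\<lambda>(g1, g2). qlift (tensor_rel s s) (\<lambda>(h1, h2). tens s s (g1 * h1) (g2 * h2)) (\<Delta> h)) (\<Delta> g)"
    and comult_one: "\<Delta> 1 = tens s s 1 1"
    and counit_mult: "\<epsilon> (g * h) = \<epsilon> g * \<epsilon> h"
    and counit_one: "\<epsilon> 1 = 1"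

locale hopf_algebra = bialgebra s \<Delta> \<epsilon>
  for s :: "'k::field \<Rightarrow> 'h::ring_1 \<Rightarrow> 'h"
    and \<Delta> :: "'h \<Rightarrow> ('h, 'h, 'k) tensor" and \<epsilon> :: "'h \<Rightarrow> 'k" +
  fixes S :: "'h \<Rightarrow> 'h"
  assumes antipode_linear: "Vector_Spaces.linear s s S"
    and antipode_left: "vlift s (\<lambda>(a, b). S a * b) (\<Delta> h) = s (\<epsilon> h) 1"
    and antipode_right: "vlift s (\<lambda>(a, b). a * S b) (\<Delta> h) = s (\<epsilon> h) 1"

section \<open>Module coalgebras and relative Hopf modules\<close>

locale right_module = unital_algebra sH + V: vector_space sV
  for sH :: "'k::field \<Rightarrow> 'h::ring_1 \<Rightarrow> 'h" and sV :: "'k \<Rightarrow> 'v::ab_group_add \<Rightarrow> 'v" +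
  fixes act :: "'v \<Rightarrow> 'h \<Rightarrow> 'v"
  assumes act_linear_left: "Vector_Spaces.linear sV sV (\<lambda>v. act v h)"
    and act_linear_right: "Vector_Spaces.linear sH sV (act v)"
    and act_one: "act v 1 = v"
    and act_mult: "act v (g * h) = act (act v g) h"

locale module_coalgebra =
  H: bialgebra sH \<Delta>H \<epsilon>H + coalgebra sC \<Delta>C \<epsilon>C + right_module sH sC actC
  for sH :: "'k::field \<Rightarrow> 'h::ring_1 \<Rightarrow> 'h"
    and \<Delta>H :: "'h \<Rightarrow> ('h, 'h, 'k) tensor" and \<epsilon>H :: "'h \<Rightarrow> 'k"
    and sC :: "'k \<Rightarrow> 'c::ab_group_add \<Rightarrow> 'c"
    and \<Delta>C :: "'c \<Rightarrow> ('c, 'c, 'k) tensor" and \<epsilon>C :: "'c \<Rightarrow> 'k"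
    and actC :: "'c \<Rightarrow> 'h \<Rightarrow> 'c" +
  assumes comult_act:
      "\<Delta>C (actC c h) = qlift (tensor_rel sC sC)
         (\<lambda>(c1, c2). qlift (tensor_rel sC sC)
            (\<lambda>(h1, h2). tens sC sC (actC c1 h1) (actC c2 h2)) (\<Delta>H h)) (\<Delta>C c)"
    and counit_act: "\<epsilon>C (actC c h) = \<epsilon>C c * \<epsilon>H h"

definition module_coalgebra_map ::
    "('k::field \<Rightarrow> 'c::ab_group_add \<Rightarrow> 'c) \<Rightarrow> ('c \<Rightarrow> ('c, 'c, 'k) tensor) \<Rightarrow> ('c \<Rightarrow> 'k) \<Rightarrow>
       ('c \<Rightarrow> 'h \<Rightarrow> 'c) \<Rightarrow>
     ('k \<Rightarrow> 'd::ab_group_add \<Rightarrow> 'd) \<Rightarrow> ('d \<Rightarrow> ('d, 'd, 'k) tensor) \<Rightarrow> ('d \<Rightarrow> 'k) \<Rightarrow>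
       ('d \<Rightarrow> 'h \<Rightarrow> 'd) \<Rightarrow>
     ('c \<Rightarrow> 'd) \<Rightarrow> bool" where
  "module_coalgebra_map sC \<Delta>C \<epsilon>C actC sD \<Delta>D \<epsilon>D actD \<phi> \<longleftrightarrow>
     Vector_Spaces.linear sC sD \<phi> \<and>
     (\<forall>c. \<Delta>D (\<phi> c) = tensor_map sD sD \<phi> \<phi> (\<Delta>C c)) \<and>
     (\<forall>c. \<epsilon>D (\<phi> c) = \<epsilon>C c) \<and>
     (\<forall>c h. \<phi> (actC c h) = actD (\<phi> c) h)"

locale relative_hopf_module =
  C: module_coalgebra sH \<Delta>H \<epsilon>H sC \<Delta>C \<epsilon>C actC +
  right_comodule sC \<Delta>C \<epsilon>C sM \<rho> + right_module sH sM actM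
  for sH :: "'k::field \<Rightarrow> 'h::ring_1 \<Rightarrow> 'h"
    and \<Delta>H :: "'h \<Rightarrow> ('h, 'h, 'k) tensor" and \<epsilon>H :: "'h \<Rightarrow> 'k"
    and sC :: "'k \<Rightarrow> 'c::ab_group_add \<Rightarrow> 'c"
    and \<Delta>C :: "'c \<Rightarrow> ('c, 'c, 'k) tensor" and \<epsilon>C :: "'c \<Rightarrow> 'k"
    and actC :: "'c \<Rightarrow> 'h \<Rightarrow> 'c"
    and sM :: "'k \<Rightarrow> 'm::ab_group_add \<Rightarrow> 'm"
    and \<rho> :: "'m \<Rightarrow> ('m, 'c, 'k) tensor" and actM :: "'m \<Rightarrow> 'h \<Rightarrow> 'm" +
  assumes coaction_act:
      "\<rho> (actM m h) = qlift (tensor_rel sM sC)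
         (\<lambda>(m0, m1). qlift (tensor_rel sM sC)
            (\<lambda>(h1, h2). tens sM sC (actM m0 h1) (actC m1 h2)) (\<Delta>H h)) (\<rho> m)"

section \<open>Rota-Baxter paired comodules\<close>

locale rota_baxter_paired_comodule = right_comodule sC \<Delta> \<epsilon> sM \<rho>
  for sC :: "'k::field \<Rightarrow> 'c::ab_group_add \<Rightarrow> 'c"
    and \<Delta> :: "'c \<Rightarrow> ('c, 'c, 'k) tensor" and \<epsilon> :: "'c \<Rightarrow> 'k"
    and sM :: "'k \<Rightarrow> 'm::ab_group_add \<Rightarrow> 'm" and \<rho> :: "'m \<Rightarrow> ('m, 'c, 'k) tensor" +
  fixes P :: "'c \<Rightarrow> 'c" and T :: "'m \<Rightarrow> 'm" and weight :: 'k
  assumes P_linear: "Vector_Spaces.linear sC sC P"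
    and T_linear: "Vector_Spaces.linear sM sM T"
    and rota_baxter:
      "tensor_map sM sC T P (\<rho> m) =
         qadd (tensor_rel sM sC)
           (qadd (tensor_rel sM sC)
              (tensor_map sM sC id P (\<rho> (T m)))
              (tensor_map sM sC T id (\<rho> (T m))))
           (qscale (tensor_rel sM sC) weight (\<rho> (T m)))"

end

theory Submission
  imports Defs
begin

text \<open>
  The antipode reverses products and coproducts, so \<open>E (m \<cdot> h) = \<epsilon>(h) E m\<close> and
  \<open>\<rho> (E_M m) = m\<^sub>0 \<cdot> S\<phi>(m\<^sub>2) \<otimes> E_C m\<^sub>1\<close>.  By the former, \<open>E_C\<close> is idempotent.
  Hence \<open>id \<otimes> E_C\<close> fixes \<open>\<rho> (E_M m)\<close>, while \<open>E_M \<otimes> id\<close> sends it to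
  \<open>E_M m\<^sub>0 \<otimes> E_C m\<^sub>1\<close>, and the Rota-Baxter identity of weight \<open>-1\<close> is what remains.

  Since linear forms separate the points of a vector space, and bilinear forms those of a tensor
  product, each Sweedler identity is checked after applying a form, as an identity of iterated
  scalar sums.
\<close>

section \<open>Linear forms\<close>

text \<open>Unlike \<open>Vector_Spaces.linear\<close>, this does not include that \<open>s\<close>
  is a vector space, so it unfolds to bare equations that simplification can check slot by
  slot.\<close>

definition linform :: "('k::field \<Rightarrow> 'v::ab_group_add \<Rightarrow> 'v) \<Rightarrow> ('v \<Rightarrow> 'k) \<Rightarrow> bool" where
  "linform s g \<longleftrightarrow> (\<forall>x y. g (x + y) = g x + g y) \<and> (\<forall>r x. g (s r x) = r * g x)"

lemma vector_space_field: "vector_space ((*) :: 'k::field \<Rightarrow> 'k \<Rightarrow> 'k)"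
  by unfold_locales (simp_all add: algebra_simps)

lemma linform_iff_linear:
  assumes "vector_space s"
  shows "linform s g \<longleftrightarrow> Vector_Spaces.linear s (*) g"
  using assms by (simp add: linform_def Vector_Spaces.linear_iff vector_space_field)

lemma linformD:
  assumes "linform s g"
  shows "g (x + y) = g x + g y" "g (s r x) = r * g x" "g 0 = 0" "g (- x) = - g x"
    "g (x - y) = g x - g y" "g (sum h A) = (\<Sum>a\<in>A. g (h a))"
proof -
  show add: "g (x + y) = g x + g y" for x y using assms by (simp add: linform_def)
  show "g (s r x) = r * g x" using assms by (simp add: linform_def)
  show zero: "g 0 = 0" using add[of 0 0] by (metis add_0 add_right_cancel)
  show neg: "g (- x) = - g x" for x using add[of x "- x"] zero by (simp add: eq_neg_iff_add_eq_0 add.commute)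
  show "g (x - y) = g x - g y" using add[of x "- y"] neg by simp
  show "g (sum h A) = (\<Sum>a\<in>A. g (h a))"
    by (induction A rule: infinite_finite_induct) (simp_all add: zero add)
qed

text \<open>A basis of \<open>N\<close> stays independent when \<open>p\<close> is added. So some
  linear form takes the value 1 at \<open>p\<close> and 0 on the basis, hence 0 on all of
  \<open>N\<close>.\<close>

lemma exists_separating_form:
  assumes "vector_space s" and "module.subspace s N" and "p \<notin> N"
  obtains g where "linform s g" "\<And>q. q \<in> N \<Longrightarrow> g q = 0" "g p = 1"
proof -
  interpret vector_space s by fact
  interpret vector_space_pair s "(*)" by (intro vector_space_pair.intro assms vector_space_field)
  obtain B where B: "B \<subseteq> N" "independent B" "N \<subseteq> span B"
    using maximal_independent_subset by blast
  have sp: "span B = N"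
    using B span_minimal[OF B(1) assms(2)] by blast
  have "independent (insert p B)" using independent_insertI[of p B] B sp assms(3) by simp
  from linear_independent_extend[OF this, of "\<lambda>x. if x = p then 1 else 0"]
  obtain g where g: "Vector_Spaces.linear s (*) g" "\<forall>x\<in>insert p B. g x = (if x = p then 1 else 0)"
    by blast
  have "g q = 0" if "q \<in> N" for q
  proof (rule linear_eq_0_on_span[OF g(1)])
    show "q \<in> span B" using that sp by simp
    show "g x = 0" if "x \<in> B" for x using that g(2) B(1) assms(3) by auto
  qed
  moreover have "g p = 1" using g(2) by simp
  moreover have "linform s g" using g(1) assms(1) by (simp add: linform_iff_linear)
  ultimately show thesis using that by blast
qed

lemma linform_eqI:
  assumes "vector_space s" and "\<And>g. linform s g \<Longrightarrow> g x = g y"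
  shows "x = y"
proof (rule ccontr)
  assume "x \<noteq> y"
  interpret vector_space s by fact
  have "x - y \<notin> {0}" using \<open>x \<noteq> y\<close> by simp
  then obtain g where "linform s g" "g (x - y) = 1"
    using exists_separating_form[OF assms(1) subspace_single_0] by blast
  then show False using assms(2)[of g] by (simp add: linformD)
qed

section \<open>Evaluation of forms on quotients of free vector spaces\<close>

lemma lookup_fscale [simp]: "Poly_Mapping.lookup (fscale r p) x = r * Poly_Mapping.lookup p x"
  by (simp add: fscale_def Poly_Mapping.map.rep_eq when_def)

lemma vector_space_fscale: "vector_space (fscale :: 'k::field \<Rightarrow> ('x \<Rightarrow>\<^sub>0 'k) \<Rightarrow> _)"
  by unfold_locales (auto intro!: poly_mapping_eqI simp: lookup_add algebra_simps)

lemma subspace_span_fscale: "module.subspace fscale (module.span fscale G)"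
proof -
  interpret vector_space "fscale :: 'a \<Rightarrow> ('b \<Rightarrow>\<^sub>0 'a) \<Rightarrow> _" by (rule vector_space_fscale)
  show ?thesis by simp
qed

section \<open>Linear extensions of functions on a basis\<close>

lemma lin_ext_mono_neutral:
  assumes "vector_space s" and "finite A" and "Poly_Mapping.keys p \<subseteq> A"
  shows "lin_ext s f p = (\<Sum>x\<in>A. s (Poly_Mapping.lookup p x) (f x))"
proof -
  interpret vector_space s by fact
  show ?thesis unfolding lin_ext_def
    by (rule sum.mono_neutral_left) (use assms in \<open>auto simp: in_keys_iff\<close>)
qed

lemma lin_ext_linear:
  assumes "vector_space s"
  shows "lin_ext s f (p + q) = lin_ext s f p + lin_ext s f q"
    "lin_ext s f (fscale r p) = s r (lin_ext s f p)"
proof -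
  interpret vector_space s by fact
  let ?A = "Poly_Mapping.keys p \<union> Poly_Mapping.keys q"
  have "Poly_Mapping.keys (p + q) \<subseteq> ?A" by (rule Poly_Mapping.keys_add)
  then show "lin_ext s f (p + q) = lin_ext s f p + lin_ext s f q"
    by (simp add: lin_ext_mono_neutral[OF assms, of ?A] lookup_add scale_left_distrib sum.distrib)
  have "Poly_Mapping.keys (fscale r p) \<subseteq> Poly_Mapping.keys p" by (auto simp: in_keys_iff)
  then show "lin_ext s f (fscale r p) = s r (lin_ext s f p)"
    by (simp add: lin_ext_mono_neutral[OF assms, of "Poly_Mapping.keys p"] scale_sum_right)
qed

lemma linform_lin_ext [simp]: "linform fscale (lin_ext (*) f)"
  using lin_ext_linear[OF vector_space_field] by (auto simp: linform_def)

lemmas lin_ext_form = linformD[OF linform_lin_ext]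

lemma lin_ext_single [simp]:
  assumes "vector_space s"
  shows "lin_ext s f (Poly_Mapping.single x 1) = f x"
proof -
  interpret vector_space s by fact
  show ?thesis by (simp add: lin_ext_def)
qed

lemma linform_lin_ext_comp:
  assumes "linform s g"
  shows "g (lin_ext s f p) = lin_ext (*) (\<lambda>x. g (f x)) p"
  by (simp add: lin_ext_def linformD[OF assms])

lemma lin_ext_lin_ext: "lin_ext (*) f (lin_ext fscale h p) = lin_ext (*) (\<lambda>x. lin_ext (*) f (h x)) p"
  by (rule linform_lin_ext_comp[OF linform_lin_ext])

lemma lin_ext_singles: "lin_ext fscale (\<lambda>x. Poly_Mapping.single x 1) p = p"
proof (rule poly_mapping_eqI)
  fix y
  show "Poly_Mapping.lookup (lin_ext fscale (\<lambda>x. Poly_Mapping.single x 1) p) y = Poly_Mapping.lookup p y"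
    by (simp add: lin_ext_def Poly_Mapping.lookup_sum lookup_single in_keys_iff when_def
        if_distrib[of "(*) c" for c] cong: if_cong)
qed

text \<open>These are the functions on the basis whose linear extension descends to the quotient by
  \<open>N\<close>; they stand for the dual space of that quotient.\<close>

definition annihilates :: "('x \<Rightarrow>\<^sub>0 'k::field) set \<Rightarrow> ('x \<Rightarrow> 'k) \<Rightarrow> bool" where
  "annihilates N f \<longleftrightarrow> (\<forall>p\<in>N. lin_ext (*) f p = 0)"

lemma annihilates_span:
  fixes f :: "'x \<Rightarrow> 'k::field"
  assumes "\<And>p. p \<in> G \<Longrightarrow> lin_ext (*) f p = 0"
  shows "annihilates (module.span fscale G) f"
proof -
  interpret vector_space "fscale :: 'k \<Rightarrow> ('x \<Rightarrow>\<^sub>0 'k) \<Rightarrow> _" by (rule vector_space_fscale)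
  interpret vector_space_pair "fscale :: 'k \<Rightarrow> ('x \<Rightarrow>\<^sub>0 'k) \<Rightarrow> _" "(*)"
    by (intro vector_space_pair.intro vector_space_fscale vector_space_field)
  have "Vector_Spaces.linear fscale (*) (lin_ext (*) f)"
    by (simp add: linform_iff_linear[OF vector_space_fscale, symmetric])
  from linear_eq_0_on_span[OF this] show ?thesis
    unfolding annihilates_def using assms by blast
qed

text \<open>
  For a coset \<open>X\<close> of \<open>N\<close> the value depends on the choice of representative unless \<open>f\<close>
  annihilates \<open>N\<close>.  With a fixed representative, linearity in \<open>f\<close> and the interchange of two
  evaluations hold without side conditions.
\<close>

definition ev :: "('x \<Rightarrow>\<^sub>0 'k::field) set \<Rightarrow> ('x \<Rightarrow> 'k) \<Rightarrow> 'k" where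
  "ev X f = lin_ext (*) f (SOME p. p \<in> X)"

lemma ev_linear:
  "ev X (\<lambda>x. f x + g x) = ev X f + ev X g"
  "ev X (\<lambda>x. r * f x) = r * ev X f"
  "ev X (\<lambda>x. f x * r) = ev X f * r"
  by (simp_all add: ev_def lin_ext_def sum.distrib sum_distrib_left sum_distrib_right algebra_simps)

lemma ev_swap:
  fixes f :: "'x \<Rightarrow> 'y \<Rightarrow> 'k::field"
  shows "ev X (\<lambda>x. ev Y (f x)) = ev Y (\<lambda>y. ev X (\<lambda>x. f x y))"
proof -
  have "(\<Sum>x\<in>A. \<alpha> x * (\<Sum>y\<in>B. \<beta> y * f x y)) = (\<Sum>y\<in>B. \<beta> y * (\<Sum>x\<in>A. \<alpha> x * f x y))"
    for A :: "'x set" and B :: "'y set" and \<alpha> :: "'x \<Rightarrow> 'k" and \<beta> :: "'y \<Rightarrow> 'k"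
    unfolding sum_distrib_left by (subst sum.swap) (simp add: mult.left_commute)
  then show ?thesis by (simp add: ev_def lin_ext_def)
qed

section \<open>Cosets of a subspace and the operations on the quotient\<close>

context
  fixes N :: "('x \<Rightarrow>\<^sub>0 'k::field) set"
  assumes subspace_N: "module.subspace fscale N"
begin

interpretation vector_space "fscale :: 'k \<Rightarrow> ('x \<Rightarrow>\<^sub>0 'k) \<Rightarrow> _" by (rule vector_space_fscale)

lemma coset_self: "p \<in> coset N p"
  using subspace_0[OF subspace_N] by (simp add: coset_def)

lemma coset_eq_iff: "coset N p = coset N q \<longleftrightarrow> p - q \<in> N"
proof
  assume "coset N p = coset N q"
  then show "p - q \<in> N" using coset_self[of p] by (simp add: coset_def)
next
  assume *: "p - q \<in> N"
  have "r - p \<in> N \<longleftrightarrow> r - q \<in> N" for r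
    using subspace_add[OF subspace_N, of "r - p" "p - q"] subspace_diff[OF subspace_N, of "r - q" "p - q"] *
    by auto
  then show "coset N p = coset N q" by (auto simp: coset_def)
qed

text \<open>Forms that vanish on \<open>N\<close> detect whether \<open>p - q\<close> lies in
  \<open>N\<close>, so they separate cosets.\<close>

lemma coset_eq_iff_forms:
  "coset N p = coset N q \<longleftrightarrow> (\<forall>f. annihilates N f \<longrightarrow> lin_ext (*) f p = lin_ext (*) f q)"
proof
  assume "coset N p = coset N q"
  then have "p - q \<in> N" by (simp add: coset_eq_iff)
  then show "\<forall>f. annihilates N f \<longrightarrow> lin_ext (*) f p = lin_ext (*) f q"
    by (auto simp: annihilates_def lin_ext_form)
next
  assume *: "\<forall>f. annihilates N f \<longrightarrow> lin_ext (*) f p = lin_ext (*) f q"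
  show "coset N p = coset N q"
  proof (rule ccontr)
    assume "\<not> ?thesis"
    then have "p - q \<notin> N" by (simp add: coset_eq_iff)
    then obtain g where g: "linform fscale g" "\<And>q. q \<in> N \<Longrightarrow> g q = 0" "g (p - q) = 1"
      using exists_separating_form[OF vector_space_fscale subspace_N] by metis
    \<comment> \<open>A form on the free space is the linear extension of its values on the basis,
      so the separating form \<open>g\<close> is represented by \<open>f\<close>.\<close>
    define f where "f x = g (Poly_Mapping.single x 1)" for x
    have f: "lin_ext (*) f r = g r" for r
      unfolding f_def using linform_lin_ext_comp[OF g(1), of "\<lambda>x. Poly_Mapping.single x 1" r]
      by (simp add: lin_ext_singles)
    then have "annihilates N f" using g(2) by (simp add: annihilates_def)
    then have "lin_ext (*) f p = lin_ext (*) f q" using * by blast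
    then have "g p = g q" by (simp only: f)
    then show False using g(3) by (simp add: linformD[OF g(1)])
  qed
qed

lemma qspace_eq_coset: "X \<in> qspace N \<Longrightarrow> p \<in> X \<Longrightarrow> X = coset N p"
proof -
  assume "X \<in> qspace N" "p \<in> X"
  then obtain r where "X = coset N r" "p - r \<in> N" by (auto simp: qspace_def coset_def)
  then show "X = coset N p" using coset_eq_iff[of p r] by simp
qed

lemma coset_in_qspace [simp]: "coset N p \<in> qspace N"
  by (simp add: qspace_def)

lemma qspace_nonempty: "X \<in> qspace N \<Longrightarrow> \<exists>p. p \<in> X"
  using coset_self by (auto simp: qspace_def)

lemma ev_eq_lin_ext:
  assumes "X \<in> qspace N" and "annihilates N f" and "p \<in> X"
  shows "ev X f = lin_ext (*) f p"
proof -
  have "(SOME p. p \<in> X) \<in> X" using assms(3) by (rule someI)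
  then have "coset N (SOME p. p \<in> X) = coset N p"
    using qspace_eq_coset[OF assms(1)] assms(3) by metis
  then show ?thesis using assms(2) unfolding coset_eq_iff_forms ev_def by blast
qed

lemma ev_coset: "annihilates N f \<Longrightarrow> ev (coset N p) f = lin_ext (*) f p"
  by (simp add: ev_eq_lin_ext coset_self)

lemma qspace_eqI:
  assumes "X \<in> qspace N" and "Y \<in> qspace N" and "\<And>f. annihilates N f \<Longrightarrow> ev X f = ev Y f"
  shows "X = Y"
proof -
  obtain p q where [simp]: "X = coset N p" "Y = coset N q" using assms(1,2) by (auto simp: qspace_def)
  have "lin_ext (*) f p = lin_ext (*) f q" if "annihilates N f" for f
    using assms(3)[OF that] by (simp add: ev_coset that)
  then have "coset N p = coset N q" by (intro coset_eq_iff_forms[THEN iffD2] allI impI)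
  then show ?thesis by simp
qed

text \<open>\<open>qadd\<close>, \<open>qscale\<close> and \<open>qlift\<close> are unions of cosets
  over all representatives. Such a union is one coset once every form that kills \<open>N\<close>
  has a value \<open>e f\<close> independent of the representative, because these forms separate
  cosets.\<close>

lemma UN_coset_singleton:
  assumes "a \<in> A" and "\<And>b f. b \<in> A \<Longrightarrow> annihilates N f \<Longrightarrow> lin_ext (*) f (h b) = e f"
  shows "(\<Union>b\<in>A. coset N (h b)) = coset N (h a)"
proof -
  have "coset N (h b) = coset N (h a)" if "b \<in> A" for b
    unfolding coset_eq_iff_forms using assms(2)[OF that] assms(2)[OF assms(1)] by presburger
  then show ?thesis by (intro UN_constant_eq[OF assms(1)]) blast
qed

lemma UN_UN_coset_singleton:
  assumes "a \<in> A" "b \<in> B"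
    and "\<And>x y f. x \<in> A \<Longrightarrow> y \<in> B \<Longrightarrow> annihilates N f \<Longrightarrow> lin_ext (*) f (h x y) = e f"
  shows "(\<Union>x\<in>A. \<Union>y\<in>B. coset N (h x y)) = coset N (h a b)"
proof -
  have "(\<Union>y\<in>B. coset N (h x y)) = coset N (h x b)" if "x \<in> A" for x
    by (rule UN_coset_singleton[OF assms(2), where e = e]) (rule assms(3)[OF that])
  then have "(\<Union>x\<in>A. \<Union>y\<in>B. coset N (h x y)) = (\<Union>x\<in>A. coset N (h x b))" by simp
  also have "\<dots> = coset N (h a b)"
    by (rule UN_coset_singleton[OF assms(1), where e = e]) (rule assms(3)[OF _ assms(2)])
  finally show ?thesis .
qed

lemma ev_qadd:
  assumes "X \<in> qspace N" "Y \<in> qspace N"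
  shows "qadd N X Y \<in> qspace N" and "annihilates N f \<Longrightarrow> ev (qadd N X Y) f = ev X f + ev Y f"
proof -
  obtain p q where pq: "p \<in> X" "q \<in> Y" using qspace_nonempty assms by meson
  have *: "qadd N X Y = coset N (p + q)" unfolding qadd_def
    by (rule UN_UN_coset_singleton[OF pq, where e = "\<lambda>f. ev X f + ev Y f"])
      (simp add: lin_ext_form ev_eq_lin_ext[OF assms(1)] ev_eq_lin_ext[OF assms(2)])
  then show "qadd N X Y \<in> qspace N" by simp
  show "annihilates N f \<Longrightarrow> ev (qadd N X Y) f = ev X f + ev Y f"
    using pq assms by (simp add: * ev_coset lin_ext_form ev_eq_lin_ext)
qed

lemma ev_qscale:
  assumes "X \<in> qspace N"
  shows "qscale N r X \<in> qspace N" and "annihilates N f \<Longrightarrow> ev (qscale N r X) f = r * ev X f"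
proof -
  obtain p where p: "p \<in> X" using qspace_nonempty assms by meson
  have "qscale N r X = coset N (fscale r p)" unfolding qscale_def
    by (rule UN_coset_singleton[OF p, where e = "\<lambda>f. r * ev X f"])
      (simp add: lin_ext_form ev_eq_lin_ext[OF assms])
  then show "qscale N r X \<in> qspace N"
    and "annihilates N f \<Longrightarrow> ev (qscale N r X) f = r * ev X f"
    using p assms by (simp_all add: ev_coset lin_ext_form ev_eq_lin_ext)
qed

lemma linear_to_quotientD:
  assumes "linear_to_quotient s N F"
  shows "F v \<in> qspace N" and "annihilates N f \<Longrightarrow> linform s (\<lambda>v. ev (F v) f)"
proof -
  have F: "\<And>v. F v \<in> qspace N" "\<And>v w. F (v + w) = qadd N (F v) (F w)"
    "\<And>r v. F (s r v) = qscale N r (F v)"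
    using assms by (auto simp: linear_to_quotient_def)
  show "F v \<in> qspace N" by (rule F)
  show "linform s (\<lambda>v. ev (F v) f)" if "annihilates N f"
    unfolding linform_def F(2,3) using ev_qadd(2)[OF F(1) F(1) that] ev_qscale(2)[OF F(1) that] by blast
qed

text \<open>\<open>the_elem\<close> is meaningful only if all representatives of \<open>X\<close>
  have the same image. Each \<open>g\<close> composed with \<open>f\<close> descends to the
  quotient, so no linear form distinguishes two images, and linear forms separate vectors.\<close>

lemma vlift_form:
  assumes "vector_space s" and "X \<in> qspace N" and "linform s g"
    and "\<And>g. linform s g \<Longrightarrow> annihilates N (\<lambda>x. g (f x))"
  shows "g (vlift s f X) = ev X (\<lambda>x. g (f x))"
proof -
  obtain p where p: "p \<in> X" using qspace_nonempty[OF assms(2)] by blast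
  have form: "g (lin_ext s f q) = ev X (\<lambda>x. g (f x))" if "linform s g" "q \<in> X" for g q
    using linform_lin_ext_comp[OF that(1), of f q] ev_eq_lin_ext[OF assms(2) assms(4)[OF that(1)] that(2)]
    by simp
  have "lin_ext s f q = lin_ext s f p" if "q \<in> X" for q
  proof (rule linform_eqI[OF assms(1)])
    fix g assume "linform s g"
    then show "g (lin_ext s f q) = g (lin_ext s f p)" using form[of g] that p by simp
  qed
  then have "lin_ext s f ` X = (\<lambda>_. lin_ext s f p) ` X" by (intro image_cong[OF refl])
  then have "lin_ext s f ` X = {lin_ext s f p}" by (simp only: image_constant[OF p])
  then show ?thesis
    using form[OF assms(3) p] by (simp add: vlift_def)
qed

end

lemma ev_qlift:
  fixes N :: "('x \<Rightarrow>\<^sub>0 'k::field) set" and N' :: "('y \<Rightarrow>\<^sub>0 'k) set"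
  assumes N: "module.subspace fscale N"
    and X: "X \<in> qspace N'" and N': "module.subspace fscale N'"
    and F: "\<And>y. F y \<in> qspace N"
    and ann: "\<And>f. annihilates N f \<Longrightarrow> annihilates N' (\<lambda>y. ev (F y) f)"
  shows "qlift N F X \<in> qspace N"
    and "annihilates N f \<Longrightarrow> ev (qlift N F X) f = ev X (\<lambda>y. ev (F y) f)"
proof -
  obtain p where p: "p \<in> X" using qspace_nonempty[OF N' X] by blast
  \<comment> \<open>One representative in each coset \<open>F y\<close>; by \<open>key\<close> any
    other choice has the same values under forms that kill \<open>N\<close>.\<close>
  obtain h where h: "\<And>y. h y \<in> F y" using qspace_nonempty[OF N F] by metis
  have key: "lin_ext (*) f (lin_ext fscale h' q) = ev X (\<lambda>y. ev (F y) f)"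
    if "q \<in> X" "h' \<in> {f. \<forall>x. f x \<in> F x}" "annihilates N f" for f q h'
  proof -
    have "ev (F y) f = lin_ext (*) f (h' y)" for y
      using that by (intro ev_eq_lin_ext[OF N F]) auto
    then have "lin_ext (*) f (lin_ext fscale h' q) = lin_ext (*) (\<lambda>y. ev (F y) f) q"
      by (simp add: lin_ext_lin_ext)
    also have "\<dots> = ev X (\<lambda>y. ev (F y) f)"
      using that ev_eq_lin_ext[OF N' X ann, of f q] by auto
    finally show ?thesis .
  qed
  have *: "qlift N F X = coset N (lin_ext fscale h p)" unfolding qlift_def
    by (rule UN_UN_coset_singleton[OF N p _ key]) (use h in simp_all)
  then show "qlift N F X \<in> qspace N" by (simp add: coset_in_qspace[OF N])
  show "annihilates N f \<Longrightarrow> ev (qlift N F X) f = ev X (\<lambda>y. ev (F y) f)"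
    using key[of p h f] p h by (simp add: * ev_coset[OF N])
qed

section \<open>Bilinear forms on tensor products\<close>

definition bilform ::
    "('k::field \<Rightarrow> 'a::ab_group_add \<Rightarrow> 'a) \<Rightarrow> ('k \<Rightarrow> 'b::ab_group_add \<Rightarrow> 'b) \<Rightarrow> ('a \<Rightarrow> 'b \<Rightarrow> 'k) \<Rightarrow> bool" where
  "bilform sA sB f \<longleftrightarrow> (\<forall>b. linform sA (\<lambda>a. f a b)) \<and> (\<forall>a. linform sB (f a))"

definition trilform ::
    "('k::field \<Rightarrow> 'a::ab_group_add \<Rightarrow> 'a) \<Rightarrow> ('k \<Rightarrow> 'b::ab_group_add \<Rightarrow> 'b) \<Rightarrow>
     ('k \<Rightarrow> 'c::ab_group_add \<Rightarrow> 'c) \<Rightarrow> ('a \<Rightarrow> 'b \<Rightarrow> 'c \<Rightarrow> 'k) \<Rightarrow> bool" where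
  "trilform sA sB sC f \<longleftrightarrow>
     (\<forall>b c. linform sA (\<lambda>a. f a b c)) \<and> (\<forall>a c. linform sB (\<lambda>b. f a b c)) \<and> (\<forall>a b. linform sC (f a b))"

text \<open>The scalar Sweedler sum: \<open>sw (\<Delta> c) f\<close> stands for f(c_1, c_2), and
  nested sums split a leg further.\<close>

definition sw :: "('a, 'b, 'k::field) tensor \<Rightarrow> ('a \<Rightarrow> 'b \<Rightarrow> 'k) \<Rightarrow> 'k" where
  "sw X f = ev X (\<lambda>(a, b). f a b)"

lemma ev_eq_sw: "ev X F = sw X (\<lambda>a b. F (a, b))"
  by (simp add: sw_def case_prod_eta)

lemma sw_linear:
  "sw X (\<lambda>a b. f a b + g a b) = sw X f + sw X g"
  "sw X (\<lambda>a b. r * f a b) = r * sw X f"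
  "sw X (\<lambda>a b. f a b * r) = sw X f * r"
  unfolding sw_def case_prod_unfold by (rule ev_linear)+

lemma sw_swap: "sw X (\<lambda>a b. sw Y (f a b)) = sw Y (\<lambda>x y. sw X (\<lambda>a b. f a b x y))"
  unfolding sw_def case_prod_unfold by (rule ev_swap)

text \<open>On a generator the linear extension of \<open>f\<close> is the defect of additivity or
  homogeneity along the slot \<open>i\<close>.\<close>

lemma slot_rel_forms:
  "(\<forall>p\<in>slot_rel s i. lin_ext (*) f p = 0) \<longleftrightarrow> linform s (\<lambda>a. f (i a))"
proof -
  \<comment> \<open>Written as ranges, the generators turn the bounded quantifier into plain
    quantifiers over vectors and scalars.\<close>
  have "slot_rel s i =
      range (\<lambda>(a, a'). Poly_Mapping.single (i (a + a')) 1 - Poly_Mapping.single (i a) 1 - Poly_Mapping.single (i a') 1) \<union>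
      range (\<lambda>(r, a). Poly_Mapping.single (i (s r a)) 1 - fscale r (Poly_Mapping.single (i a) 1))"
    unfolding slot_rel_def by (auto simp: image_iff)
  then show ?thesis
    by (simp add: ball_Un linform_def lin_ext_form vector_space_field diff_diff_eq)
qed

lemma annihilates_span_iff:
  "annihilates (module.span fscale G) f \<longleftrightarrow> (\<forall>p\<in>G. lin_ext (*) f p = 0)" for f :: "'x \<Rightarrow> 'k::field"
proof -
  interpret vector_space "fscale :: 'k \<Rightarrow> ('x \<Rightarrow>\<^sub>0 'k) \<Rightarrow> _" by (rule vector_space_fscale)
  show ?thesis
  proof
    show "\<forall>p\<in>G. lin_ext (*) f p = 0" if "annihilates (span G) f"
      using that span_base by (simp add: annihilates_def)
  qed (simp add: annihilates_span)
qed

text \<open>The universal property of the tensor product at the level of forms: the relations are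
  imposed slot by slot, and so is bilinearity.\<close>

lemma annihilates_tensor_rel:
  "annihilates (tensor_rel sA sB) F \<longleftrightarrow> bilform sA sB (\<lambda>a b. F (a, b))"
  unfolding tensor_rel_def annihilates_span_iff bilform_def ball_Un ball_UN slot_rel_forms by simp

lemma annihilates_tensor3_rel:
  "annihilates (tensor3_rel sA sB sC) F \<longleftrightarrow> trilform sA sB sC (\<lambda>a b c. F (a, b, c))"
  unfolding tensor3_rel_def annihilates_span_iff trilform_def ball_Un ball_UN slot_rel_forms by simp

lemma subspace_tensor_rel: "module.subspace fscale (tensor_rel sA sB)"
  unfolding tensor_rel_def by (rule subspace_span_fscale)

lemma subspace_tensor3_rel: "module.subspace fscale (tensor3_rel sA sB sC)"
  unfolding tensor3_rel_def by (rule subspace_span_fscale)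

lemma tens_in_qspace [simp]: "tens sA sB a b \<in> qspace (tensor_rel sA sB)"
  by (simp add: tens_def qspace_def)

lemma tens3_in_qspace [simp]: "tens3 sA sB sC a b c \<in> qspace (tensor3_rel sA sB sC)"
  by (simp add: tens3_def qspace_def)

lemma ev_tens: "annihilates (tensor_rel sA sB) F \<Longrightarrow> ev (tens sA sB a b) F = F (a, b)"
  by (simp add: tens_def ev_coset subspace_tensor_rel vector_space_field)

lemma ev_tens3: "annihilates (tensor3_rel sA sB sC) F \<Longrightarrow> ev (tens3 sA sB sC a b c) F = F (a, b, c)"
  by (simp add: tens3_def ev_coset subspace_tensor3_rel vector_space_field)

lemma sw_tens: "bilform sA sB f \<Longrightarrow> sw (tens sA sB a b) f = f a b"
  by (simp add: sw_def ev_tens annihilates_tensor_rel)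

lemma tensor_eqI:
  assumes "X \<in> qspace (tensor_rel sA sB)" "Y \<in> qspace (tensor_rel sA sB)"
    and "\<And>f. bilform sA sB f \<Longrightarrow> sw X f = sw Y f"
  shows "X = Y"
  by (rule qspace_eqI[OF subspace_tensor_rel assms(1,2)])
    (simp add: ev_eq_sw assms(3) annihilates_tensor_rel)

lemma bilformD:
  assumes "bilform sA sB f"
  shows "f (a + a') b = f a b + f a' b" "f (sA r a) b = r * f a b"
    "f a (b + b') = f a b + f a b'" "f a (sB r b) = r * f a b"
  using assms by (simp_all add: bilform_def linform_def)

lemma sw_qadd:
  assumes "X \<in> qspace (tensor_rel sA sB)" "Y \<in> qspace (tensor_rel sA sB)"
  shows "qadd (tensor_rel sA sB) X Y \<in> qspace (tensor_rel sA sB)"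
    and "bilform sA sB f \<Longrightarrow> sw (qadd (tensor_rel sA sB) X Y) f = sw X f + sw Y f"
  using ev_qadd[OF subspace_tensor_rel assms] by (simp_all add: sw_def annihilates_tensor_rel)

lemma sw_qscale:
  assumes "X \<in> qspace (tensor_rel sA sB)"
  shows "qscale (tensor_rel sA sB) r X \<in> qspace (tensor_rel sA sB)"
    and "bilform sA sB f \<Longrightarrow> sw (qscale (tensor_rel sA sB) r X) f = r * sw X f"
  using ev_qscale[OF subspace_tensor_rel assms] by (simp_all add: sw_def annihilates_tensor_rel)

lemma sw_vlift:
  assumes "vector_space s" and "X \<in> qspace (tensor_rel sA sB)"
    and "\<And>g. linform s g \<Longrightarrow> bilform sA sB (\<lambda>a b. g (f a b))" and "linform s g"
  shows "g (vlift s (\<lambda>(a, b). f a b) X) = sw X (\<lambda>a b. g (f a b))"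
proof -
  have "g (vlift s (\<lambda>(a, b). f a b) X) = ev X (\<lambda>x. g (case x of (a, b) \<Rightarrow> f a b))"
    by (rule vlift_form[OF subspace_tensor_rel assms(1,2,4)])
      (simp add: annihilates_tensor_rel assms(3))
  then show ?thesis by (simp add: ev_eq_sw)
qed

lemma sw_qlift:
  assumes X: "X \<in> qspace (tensor_rel sA sB)" and N: "module.subspace fscale N"
    and G: "\<And>a b. G a b \<in> qspace N"
    and bil: "\<And>F. annihilates N F \<Longrightarrow> bilform sA sB (\<lambda>a b. ev (G a b) F)"
  shows "qlift N (\<lambda>(a, b). G a b) X \<in> qspace N"
    and "annihilates N F \<Longrightarrow> ev (qlift N (\<lambda>(a, b). G a b) X) F = sw X (\<lambda>a b. ev (G a b) F)"
proof -
  have ann: "annihilates (tensor_rel sA sB) (\<lambda>y. ev (case y of (a, b) \<Rightarrow> G a b) F)"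
    if "annihilates N F" for F
    using bil[OF that] by (simp add: annihilates_tensor_rel)
  have GG: "(case y of (a, b) \<Rightarrow> G a b) \<in> qspace N" for y by (simp add: G split: prod.split)
  show "qlift N (\<lambda>(a, b). G a b) X \<in> qspace N"
    by (rule ev_qlift(1)[OF N X subspace_tensor_rel GG ann])
  show "annihilates N F \<Longrightarrow> ev (qlift N (\<lambda>(a, b). G a b) X) F = sw X (\<lambda>a b. ev (G a b) F)"
    using ev_qlift(2)[OF N X subspace_tensor_rel GG ann] by (simp add: ev_eq_sw)
qed

text \<open>The common shape of coassociativity and of the compatibility of a coaction with an
  action. Two nested lifts become two nested scalar sums.\<close>

lemma sw_qlift_qlift:
  assumes X: "X \<in> qspace (tensor_rel sA sB)" and N: "module.subspace fscale N"
    and Z: "\<And>a b. Z a b \<in> qspace (tensor_rel sX sY)"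
    and G: "\<And>a b x y. G a b x y \<in> qspace N"
    and bil: "\<And>F a b. annihilates N F \<Longrightarrow> bilform sX sY (\<lambda>x y. ev (G a b x y) F)"
    and bil': "\<And>F. annihilates N F \<Longrightarrow> bilform sA sB (\<lambda>a b. sw (Z a b) (\<lambda>x y. ev (G a b x y) F))"
    and F: "annihilates N F"
  shows "ev (qlift N (\<lambda>(a, b). qlift N (\<lambda>(x, y). G a b x y) (Z a b)) X) F =
    sw X (\<lambda>a b. sw (Z a b) (\<lambda>x y. ev (G a b x y) F))"
proof -
  have inner: "qlift N (\<lambda>(x, y). G a b x y) (Z a b) \<in> qspace N"
    "annihilates N F \<Longrightarrow> ev (qlift N (\<lambda>(x, y). G a b x y) (Z a b)) F = sw (Z a b) (\<lambda>x y. ev (G a b x y) F)"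
    for a b F
    using sw_qlift[where G = "G a b", OF Z N G bil] by blast+
  show ?thesis
    by (subst sw_qlift(2)[OF X N]) (simp_all add: inner F bil')
qed

lemma sw_tensor_map:
  assumes "X \<in> qspace (tensor_rel sA sB)"
    and "\<And>f. bilform sC sD f \<Longrightarrow> bilform sA sB (\<lambda>a b. f (F a) (G b))"
  shows "tensor_map sC sD F G X \<in> qspace (tensor_rel sC sD)"
    and "bilform sC sD f \<Longrightarrow> sw (tensor_map sC sD F G X) f = sw X (\<lambda>a b. f (F a) (G b))"
proof -
  have bil: "bilform sA sB (\<lambda>a b. ev (tens sC sD (F a) (G b)) f)" if "annihilates (tensor_rel sC sD) f" for f
    using assms(2) that by (simp add: ev_tens annihilates_tensor_rel)
  note q = sw_qlift[where G = "\<lambda>a b. tens sC sD (F a) (G b)",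
      OF assms(1) subspace_tensor_rel tens_in_qspace bil]
  show "tensor_map sC sD F G X \<in> qspace (tensor_rel sC sD)"
    unfolding tensor_map_def by (rule q)
  show "bilform sC sD f \<Longrightarrow> sw (tensor_map sC sD F G X) f = sw X (\<lambda>a b. f (F a) (G b))"
    using q(2)[of "\<lambda>(a, b). f a b"]
    by (simp add: tensor_map_def sw_def[of "qlift _ _ _"] ev_tens annihilates_tensor_rel)
qed

lemma linear_to_tensorD:
  assumes "linear_to_quotient s (tensor_rel sA sB) \<rho>"
  shows "\<rho> m \<in> qspace (tensor_rel sA sB)"
    and "bilform sA sB f \<Longrightarrow> linform s (\<lambda>m. sw (\<rho> m) f)"
  using linear_to_quotientD[OF subspace_tensor_rel assms] by (simp_all add: sw_def annihilates_tensor_rel)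

lemma linear_to_tensor_simps:
  assumes "linear_to_quotient s (tensor_rel sA sB) \<rho>" and "bilform sA sB f"
  shows "sw (\<rho> (x + y)) f = sw (\<rho> x) f + sw (\<rho> y) f" and "sw (\<rho> (s r x)) f = r * sw (\<rho> x) f"
  using linear_to_tensorD(2)[OF assms] by (simp_all add: linform_def)

section \<open>The axioms of comodules, coalgebras and Hopf modules as scalar Sweedler sums\<close>

context right_comodule
begin

lemmas sw_coaction = linear_to_tensor_simps[OF coaction_linear]
lemmas sw_comult = linear_to_tensor_simps[OF comult_linear]
lemmas coaction_in_qspace [simp] = linear_to_tensorD(1)[OF coaction_linear]
lemmas comult_in_qspace [simp] = linear_to_tensorD(1)[OF comult_linear]

text \<open>A trilinear \<open>f\<close> descends to the threefold tensor product, so it may be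
  evaluated on both sides of the axiom. This is the rule by which legs are regrouped later.\<close>

lemma sw_coaction_coassoc:
  assumes "trilform sM sC sC f"
  shows "sw (\<rho> m) (\<lambda>a b. sw (\<rho> a) (\<lambda>x y. f x y b)) = sw (\<rho> m) (\<lambda>a b. sw (\<Delta> b) (\<lambda>x y. f a x y))"
proof -
  let ?N = "tensor3_rel sM sC sC" and ?F = "\<lambda>(x, y, z). f x y z"
  have F: "annihilates ?N ?F" using assms by (simp add: annihilates_tensor3_rel)
  have "ev (qlift ?N (\<lambda>(a, b). qlift ?N (\<lambda>(x, y). tens3 sM sC sC x y b) (\<rho> a)) (\<rho> m)) ?F =
      sw (\<rho> m) (\<lambda>a b. sw (\<rho> a) (\<lambda>x y. ev (tens3 sM sC sC x y b) ?F))"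
    by (rule sw_qlift_qlift[OF coaction_in_qspace subspace_tensor3_rel coaction_in_qspace tens3_in_qspace _ _ F])
      (simp_all add: ev_tens3 annihilates_tensor3_rel trilform_def bilform_def linform_def sw_coaction sw_linear)
  moreover have "ev (qlift ?N (\<lambda>(a, b). qlift ?N (\<lambda>(x, y). tens3 sM sC sC a x y) (\<Delta> b)) (\<rho> m)) ?F =
      sw (\<rho> m) (\<lambda>a b. sw (\<Delta> b) (\<lambda>x y. ev (tens3 sM sC sC a x y) ?F))"
    by (rule sw_qlift_qlift[OF coaction_in_qspace subspace_tensor3_rel comult_in_qspace tens3_in_qspace _ _ F])
      (simp_all add: ev_tens3 annihilates_tensor3_rel trilform_def bilform_def linform_def sw_comult sw_linear)
  ultimately show ?thesis using F coaction_coassoc[of m] by (simp add: ev_tens3)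
qed

lemma sw_coaction_counit:
  assumes "linform sM g"
  shows "sw (\<rho> m) (\<lambda>a b. \<epsilon> b * g a) = g m"
proof -
  have "\<epsilon> (x + y) = \<epsilon> x + \<epsilon> y" "\<epsilon> (sC r x) = r * \<epsilon> x" for r x y
    using counit_linear by (simp_all add: Vector_Spaces.linear_iff)
  then have "g (vlift sM (\<lambda>(a, b). sM (\<epsilon> b) a) (\<rho> m)) = sw (\<rho> m) (\<lambda>a b. g (sM (\<epsilon> b) a))"
    by (intro sw_vlift[OF M.vector_space_axioms coaction_in_qspace _ assms])
      (simp add: bilform_def linform_def algebra_simps)
  then show ?thesis by (simp add: coaction_counit linformD[OF assms])
qed

end

lemma (in coalgebra) counit_simps:
  "\<epsilon> (x + y) = \<epsilon> x + \<epsilon> y" "\<epsilon> (s r x) = r * \<epsilon> x"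
  using counit_linear by (simp_all add: Vector_Spaces.linear_iff)

text \<open>Viewing a coalgebra as a comodule over itself yields only the right counit law; the left
  one needs this separate form.\<close>

lemma (in coalgebra) sw_counit_left:
  assumes "linform s g"
  shows "sw (\<Delta> c) (\<lambda>a b. \<epsilon> a * g b) = g c"
proof -
  have "\<epsilon> (x + y) = \<epsilon> x + \<epsilon> y" "\<epsilon> (s r x) = r * \<epsilon> x" for r x y
    using counit_linear by (simp_all add: Vector_Spaces.linear_iff)
  then have "g (vlift s (\<lambda>(a, b). s (\<epsilon> a) b) (\<Delta> c)) = sw (\<Delta> c) (\<lambda>a b. g (s (\<epsilon> a) b))"
    by (intro sw_vlift[OF vector_space_axioms linear_to_tensorD(1)[OF comult_linear] _ assms])
      (simp add: bilform_def linform_def algebra_simps)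
  then show ?thesis by (simp add: counit_left linformD[OF assms])
qed

lemma (in coalgebra) right_comodule_self: "right_comodule s \<Delta> \<epsilon> s \<Delta>"
  by unfold_locales (rule comult_linear coassoc counit_right)+

text \<open>With coaction \<open>\<Delta>C\<close>, the axiom \<open>comult_act\<close> becomes
  \<open>coaction_act\<close>. Facts about relative Hopf modules thereby apply to \<open>C\<close>,
  and to \<open>H\<close> acting on itself by multiplication.\<close>

lemma (in module_coalgebra) relative_hopf_module_self:
  "relative_hopf_module sH \<Delta>H \<epsilon>H sC \<Delta>C \<epsilon>C actC sC \<Delta>C actC"
  by (intro relative_hopf_module.intro module_coalgebra_axioms right_comodule_self
      right_module_axioms relative_hopf_module_axioms.intro comult_act)

lemma (in bialgebra) module_coalgebra_self:
  "module_coalgebra s \<Delta> \<epsilon> s \<Delta> \<epsilon> (*)"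
  by unfold_locales
    (simp_all add: Vector_Spaces.linear_iff vector_space_axioms distrib_left distrib_right
      scale_mult_left scale_mult_right mult.assoc comult_mult counit_mult)

lemma (in right_module) act_simps:
  "act (v + w) h = act v h + act w h" "act (sV r v) h = sV r (act v h)"
  "act v (h + h') = act v h + act v h'" "act v (sH r h) = sV r (act v h)"
  using act_linear_left act_linear_right by (simp_all add: Vector_Spaces.linear_iff)

lemma (in relative_hopf_module) sw_coaction_act:
  assumes "bilform sM sC f"
  shows "sw (\<rho> (actM m h)) f =
    sw (\<rho> m) (\<lambda>m0 m1. sw (\<Delta>H h) (\<lambda>h1 h2. f (actM m0 h1) (actC m1 h2)))"
proof -
  let ?F = "\<lambda>(x, y). f x y"
  have F: "annihilates (tensor_rel sM sC) ?F" using assms by (simp add: annihilates_tensor_rel)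
  have "sw (\<rho> (actM m h)) f = ev (\<rho> (actM m h)) ?F" by (simp add: sw_def)
  also have "\<dots> = sw (\<rho> m) (\<lambda>m0 m1. sw (\<Delta>H h)
      (\<lambda>h1 h2. ev (tens sM sC (actM m0 h1) (actC m1 h2)) ?F))"
    unfolding coaction_act
    by (rule sw_qlift_qlift[OF coaction_in_qspace subspace_tensor_rel
          linear_to_tensorD(1)[OF C.H.comult_linear] tens_in_qspace _ _ F])
      (simp_all add: ev_tens annihilates_tensor_rel bilform_def linform_def sw_linear act_simps C.act_simps)
  also have "\<dots> = sw (\<rho> m) (\<lambda>m0 m1. sw (\<Delta>H h) (\<lambda>h1 h2. f (actM m0 h1) (actC m1 h2)))"
    by (simp add: ev_tens F)
  finally show ?thesis .
qed

section \<open>The antipode\<close>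

context hopf_algebra
begin

text \<open>\<open>H\<close> over itself: the coaction lemmas now state coassociativity, the right
  counit law and multiplicativity of \<open>\<Delta>\<close>.\<close>

interpretation self: relative_hopf_module s \<Delta> \<epsilon> s \<Delta> \<epsilon> "(*)" s \<Delta> "(*)"
  by (rule module_coalgebra.relative_hopf_module_self[OF module_coalgebra_self])

lemma antipode_simps: "S (x + y) = S x + S y" "S (s r x) = s r (S x)"
  using antipode_linear by (simp_all add: Vector_Spaces.linear_iff)

lemmas forms = bilform_def trilform_def linform_def sw_linear self.sw_coaction antipode_simps counit_simps
  scale_mult_left scale_mult_right distrib_left distrib_right

lemma sw_antipode:
  assumes "linform s g"
  shows "sw (\<Delta> h) (\<lambda>a b. g (S a * b)) = \<epsilon> h * g 1" "sw (\<Delta> h) (\<lambda>a b. g (a * S b)) = \<epsilon> h * g 1"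
proof -
  have "g (vlift s (\<lambda>(a, b). S a * b) (\<Delta> h)) = sw (\<Delta> h) (\<lambda>a b. g (S a * b))"
    by (rule sw_vlift[OF vector_space_axioms self.coaction_in_qspace _ assms]) (simp add: forms)
  then show "sw (\<Delta> h) (\<lambda>a b. g (S a * b)) = \<epsilon> h * g 1"
    by (simp add: antipode_left linformD[OF assms])
  have "g (vlift s (\<lambda>(a, b). a * S b) (\<Delta> h)) = sw (\<Delta> h) (\<lambda>a b. g (a * S b))"
    by (rule sw_vlift[OF vector_space_axioms self.coaction_in_qspace _ assms]) (simp add: forms)
  then show "sw (\<Delta> h) (\<lambda>a b. g (a * S b)) = \<epsilon> h * g 1"
    by (simp add: antipode_right linformD[OF assms])
qed

text \<open>Apply \<open>\<epsilon>\<close> to S(h_1) h_2 = \<epsilon>(h) 1, then remove the second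
  leg by the counit law.\<close>

lemma counit_antipode: "\<epsilon> (S h) = \<epsilon> h"
proof -
  have "sw (\<Delta> h) (\<lambda>a b. \<epsilon> (S a * b)) = \<epsilon> h"
    by (subst sw_antipode) (simp_all add: forms counit_one)
  then have "sw (\<Delta> h) (\<lambda>a b. \<epsilon> b * \<epsilon> (S a)) = \<epsilon> h"
    by (simp add: counit_mult mult.commute)
  then show ?thesis
    by (subst (asm) self.sw_coaction_counit) (simp_all add: forms)
qed

text \<open>
  Both sides are convolution inverses of the multiplication \<open>H \<otimes> H \<rightarrow> H\<close>, so they agree by
  evaluating \<open>S (x\<^sub>1 y\<^sub>1) x\<^sub>2 y\<^sub>2 S y\<^sub>3 S x\<^sub>3\<close> in two ways.
\<close>

lemma antipode_mult: "S (x * y) = S y * S x"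
proof (rule linform_eqI[OF vector_space_axioms])
  fix g assume g: "linform s g"
  note gs = linformD(1,2)[OF g]
  \<comment> \<open>\<open>A\<close> is the integrand with all six legs free, and \<open>B\<close>
    sums it over the legs of \<open>y\<close> only, leaving those of \<open>x\<close> to be grouped
    later.\<close>
  define A where "A x1 x2 x3 y1 y2 y3 = g (S (x1 * y1) * (x2 * y2) * (S y3 * S x3))" for x1 x2 x3 y1 y2 y3
  define B where "B x1 x2 x3 = sw (\<Delta> y) (\<lambda>y1 v. sw (\<Delta> v) (\<lambda>y2 y3. A x1 x2 x3 y1 y2 y3))" for x1 x2 x3
  \<comment> \<open>Coassociativity groups the legs of \<open>y\<close> in two ways:
    \<open>B_def\<close> keeps \<open>y2\<close> and \<open>y3\<close> together for
    \<open>left\<close>, while \<open>B'\<close> keeps \<open>y1\<close> and \<open>y2\<close>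
    together for \<open>right\<close>.\<close>
  have B': "B x1 x2 x3 = sw (\<Delta> y) (\<lambda>v y3. sw (\<Delta> v) (\<lambda>y1 y2. A x1 x2 x3 y1 y2 y3))" for x1 x2 x3
    unfolding B_def by (rule self.sw_coaction_coassoc[symmetric]) (simp add: A_def forms gs)
  \<comment> \<open>First \<open>y2 * S y3\<close> collapses to a counit, which makes
    \<open>x2\<close> and \<open>S x3\<close> adjacent; then these collapse too.\<close>
  have left: "sw (\<Delta> u) (\<lambda>x2 x3. B x1 x2 x3) = \<epsilon> u * g (S (x1 * y))" for u x1
  proof -
    have "sw (\<Delta> v) (\<lambda>y2 y3. A x1 x2 x3 y1 y2 y3) = \<epsilon> v * g (S (x1 * y1) * x2 * S x3)" for v x2 x3 y1
      using sw_antipode(2)[of "\<lambda>z. g (S (x1 * y1) * x2 * z * S x3)" v]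
      by (simp add: A_def forms gs mult.assoc)
    then have "B x1 x2 x3 = g (S (x1 * y) * x2 * S x3)" for x2 x3
      unfolding B_def by (subst self.sw_coaction_counit[of "\<lambda>y1. g (S (x1 * y1) * x2 * S x3)", symmetric])
        (simp_all add: forms gs)
    then have "sw (\<Delta> u) (\<lambda>x2 x3. B x1 x2 x3) = sw (\<Delta> u) (\<lambda>x2 x3. g (S (x1 * y) * (x2 * S x3)))"
      by (simp add: mult.assoc)
    also have "\<dots> = \<epsilon> u * g (S (x1 * y) * 1)"
      by (rule sw_antipode(2)) (simp add: forms gs)
    finally show ?thesis by simp
  qed
  have right: "sw (\<Delta> u) (\<lambda>x1 x2. B x1 x2 x3) = \<epsilon> u * g (S y * S x3)" for u x3
  proof -
    \<comment> \<open>Since \<open>\<Delta>\<close> is multiplicative, the legs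
      \<open>x1 * y1\<close> and \<open>x2 * y2\<close> are those of \<open>u * v\<close>, so the
      left antipode axiom applies to this product as a whole.\<close>
    have *: "sw (\<Delta> u) (\<lambda>x1 x2. sw (\<Delta> v) (\<lambda>y1 y2. A x1 x2 x3 y1 y2 y3)) = \<epsilon> u * (\<epsilon> v * g (S y3 * S x3))"
      for v y3
    proof -
      have "sw (\<Delta> u) (\<lambda>x1 x2. sw (\<Delta> v) (\<lambda>y1 y2. A x1 x2 x3 y1 y2 y3)) =
          sw (\<Delta> (u * v)) (\<lambda>a b. g (S a * b * (S y3 * S x3)))"
        unfolding A_def by (rule self.sw_coaction_act[symmetric]) (simp add: forms gs)
      also have "\<dots> = \<epsilon> (u * v) * g (1 * (S y3 * S x3))"
        by (rule sw_antipode(1)) (simp add: forms gs)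
      finally show ?thesis by (simp add: counit_mult)
    qed
    have "sw (\<Delta> u) (\<lambda>x1 x2. B x1 x2 x3) = sw (\<Delta> y) (\<lambda>v y3. \<epsilon> u * (\<epsilon> v * g (S y3 * S x3)))"
      unfolding B' by (subst sw_swap) (simp add: *)
    also have "\<dots> = \<epsilon> u * sw (\<Delta> y) (\<lambda>v y3. \<epsilon> v * g (S y3 * S x3))"
      by (rule sw_linear)
    also have "sw (\<Delta> y) (\<lambda>v y3. \<epsilon> v * g (S y3 * S x3)) = g (S y * S x3)"
      by (rule sw_counit_left) (simp add: forms gs)
    finally show ?thesis .
  qed
  have "g (S (x * y)) = sw (\<Delta> x) (\<lambda>x1 u. \<epsilon> u * g (S (x1 * y)))"
    by (rule self.sw_coaction_counit[symmetric]) (simp add: forms gs)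
  also have "\<dots> = sw (\<Delta> x) (\<lambda>x1 u. sw (\<Delta> u) (\<lambda>x2 x3. B x1 x2 x3))"
    by (simp add: left)
  also have "\<dots> = sw (\<Delta> x) (\<lambda>u x3. sw (\<Delta> u) (\<lambda>x1 x2. B x1 x2 x3))"
    by (rule self.sw_coaction_coassoc[symmetric]) (simp add: B_def A_def forms gs)
  also have "\<dots> = sw (\<Delta> x) (\<lambda>u x3. \<epsilon> u * g (S y * S x3))"
    by (simp add: right)
  also have "\<dots> = g (S y * S x)"
    by (rule sw_counit_left) (simp add: forms gs)
  finally show "g (S (x * y)) = g (S y * S x)" .
qed

text \<open>For four legs of u the arguments are u_1 S(u_4) and u_2 S(u_3). The inner pair collapses
  first, after which the outer pair is adjacent and collapses as well. Thus S(w_2) \<otimes> S(w_1)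
  is a right convolution inverse of \<open>\<Delta>\<close>.\<close>

lemma sw_comult_antipode_cancel:
  assumes f: "bilform s s f"
  shows "sw (\<Delta> u) (\<lambda>v w. sw (\<Delta> v) (\<lambda>v1 v2. sw (\<Delta> w) (\<lambda>w1 w2. f (v1 * S w2) (v2 * S w1)))) = \<epsilon> u * f 1 1"
proof -
  note fs = bilformD[OF f]
  \<comment> \<open>With the first leg \<open>v1\<close> held fixed, \<open>t\<close> carries the
    other three; regrouping them puts \<open>v2\<close> and \<open>w1\<close> under one
    comultiplication.\<close>
  have inner: "sw (\<Delta> t) (\<lambda>v2 w. sw (\<Delta> w) (\<lambda>w1 w2. f (v1 * S w2) (v2 * S w1))) = f (v1 * S t) 1" for v1 t
  proof -
    have "sw (\<Delta> t) (\<lambda>v2 w. sw (\<Delta> w) (\<lambda>w1 w2. f (v1 * S w2) (v2 * S w1))) =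
        sw (\<Delta> t) (\<lambda>r w2. sw (\<Delta> r) (\<lambda>v2 w1. f (v1 * S w2) (v2 * S w1)))"
      by (rule self.sw_coaction_coassoc[symmetric]) (simp add: forms fs)
    also have "\<dots> = sw (\<Delta> t) (\<lambda>r w2. \<epsilon> r * f (v1 * S w2) 1)"
      by (subst sw_antipode(2)) (simp_all add: forms fs)
    also have "\<dots> = f (v1 * S t) 1"
      by (rule sw_counit_left) (simp add: forms fs)
    finally show ?thesis .
  qed
  have "sw (\<Delta> u) (\<lambda>v w. sw (\<Delta> v) (\<lambda>v1 v2. sw (\<Delta> w) (\<lambda>w1 w2. f (v1 * S w2) (v2 * S w1)))) =
      sw (\<Delta> u) (\<lambda>v1 t. sw (\<Delta> t) (\<lambda>v2 w. sw (\<Delta> w) (\<lambda>w1 w2. f (v1 * S w2) (v2 * S w1))))"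
    by (rule self.sw_coaction_coassoc) (simp add: forms fs)
  also have "\<dots> = sw (\<Delta> u) (\<lambda>v1 t. f (v1 * S t) 1)"
    by (simp only: inner)
  also have "\<dots> = \<epsilon> u * f 1 1"
    by (rule sw_antipode(2)) (simp add: forms fs)
  finally show ?thesis .
qed

text \<open>
  Both sides are convolution inverses of \<open>\<Delta>\<close> in \<open>Hom(H, H \<otimes> H)\<close>, so they agree by evaluating
  \<open>\<Delta> (S h\<^sub>1) \<Delta> h\<^sub>2 (S h\<^sub>4 \<otimes> S h\<^sub>3)\<close> in two ways.
\<close>

lemma sw_comult_antipode:
  assumes f: "bilform s s f"
  shows "sw (\<Delta> (S h)) f = sw (\<Delta> h) (\<lambda>a b. f (S b) (S a))"
proof -
  note fs = bilformD[OF f]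
  \<comment> \<open>\<open>A w\<close> is \<open>f\<close> after right multiplication by S(w_1) and
    S(w_2) in crossed order. With it, \<open>R\<close> evaluates \<open>f\<close> on \<Delta>(S h_1)
    \<Delta>(v) (S(w_2) \<otimes> S(w_1)).\<close>
  define A where "A w = (\<lambda>a b. sw (\<Delta> w) (\<lambda>w1 w2. f (a * S w2) (b * S w1)))" for w
  have A: "bilform s s (A w)" for w unfolding A_def by (simp add: forms fs)
  define R where "R h1 v w = sw (\<Delta> (S h1 * v)) (A w)" for h1 v w
  have R: "R h1 v w = sw (\<Delta> (S h1)) (\<lambda>p q. sw (\<Delta> v) (\<lambda>v1 v2. A w (p * v1) (q * v2)))" for h1 v w
    unfolding R_def by (rule self.sw_coaction_act[OF A])
  \<comment> \<open>After the sums are swapped, the legs \<open>p\<close>, \<open>q\<close> of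
    \<open>S h1\<close> are constant in the sum over \<open>u\<close>, so the cancellation applies
    to \<open>f\<close> multiplied by them on the left.\<close>
  have left: "sw (\<Delta> u) (\<lambda>v w. R h1 v w) = \<epsilon> u * sw (\<Delta> (S h1)) f" for u h1
  proof -
    have "sw (\<Delta> u) (\<lambda>v w. sw (\<Delta> v) (\<lambda>v1 v2. A w (p * v1) (q * v2))) = \<epsilon> u * f p q" for p q
      using sw_comult_antipode_cancel[of "\<lambda>a b. f (p * a) (q * b)" u]
      by (simp add: A_def forms fs mult.assoc)
    then have "sw (\<Delta> u) (\<lambda>v w. R h1 v w) = sw (\<Delta> (S h1)) (\<lambda>p q. \<epsilon> u * f p q)"
      unfolding R by (subst sw_swap) simp
    then show ?thesis by (simp add: sw_linear)
  qed
  \<comment> \<open>Here \<open>S h1 * v\<close> collapses before it is comultiplied, so only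
    \<open>\<Delta> 1\<close> remains.\<close>
  have right: "sw (\<Delta> u) (\<lambda>h1 v. R h1 v w) = \<epsilon> u * sw (\<Delta> w) (\<lambda>w1 w2. f (S w2) (S w1))" for u w
  proof -
    have "sw (\<Delta> u) (\<lambda>h1 v. R h1 v w) = \<epsilon> u * sw (\<Delta> 1) (A w)"
      unfolding R_def by (rule sw_antipode(1)) (simp add: linform_def self.sw_coaction A)
    also have "sw (\<Delta> 1) (A w) = A w 1 1" unfolding comult_one by (rule sw_tens[OF A])
    finally show ?thesis by (simp add: A_def)
  qed
  have "sw (\<Delta> (S h)) f = sw (\<Delta> h) (\<lambda>h1 u. \<epsilon> u * sw (\<Delta> (S h1)) f)"
    by (rule self.sw_coaction_counit[symmetric]) (simp add: forms fs)
  also have "\<dots> = sw (\<Delta> h) (\<lambda>h1 u. sw (\<Delta> u) (\<lambda>v w. R h1 v w))"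
    by (simp add: left)
  also have "\<dots> = sw (\<Delta> h) (\<lambda>u w. sw (\<Delta> u) (\<lambda>h1 v. R h1 v w))"
    by (rule self.sw_coaction_coassoc[symmetric]) (simp add: R_def A_def forms fs)
  also have "\<dots> = sw (\<Delta> h) (\<lambda>u w. \<epsilon> u * sw (\<Delta> w) (\<lambda>w1 w2. f (S w2) (S w1)))"
    by (simp add: right)
  also have "\<dots> = sw (\<Delta> h) (\<lambda>a b. f (S b) (S a))"
    by (rule sw_counit_left) (simp add: forms fs)
  finally show ?thesis .
qed

end

section \<open>Relative Hopf modules over a coalgebra that maps to the Hopf algebra\<close>

text \<open>The data are chosen so that \<open>C\<close> may take the place of \<open>M\<close>.
  Both operators of the theorem are then instances of the single operator \<open>E\<close>, and each
  fact about it is proved once.\<close>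

locale mapped_hopf_module =
  H: hopf_algebra sH \<Delta>H \<epsilon>H S + relative_hopf_module sH \<Delta>H \<epsilon>H sC \<Delta>C \<epsilon>C actC sM \<rho> actM
  for sH :: "'k::field \<Rightarrow> 'h::ring_1 \<Rightarrow> 'h"
    and \<Delta>H :: "'h \<Rightarrow> ('h, 'h, 'k) tensor" and \<epsilon>H :: "'h \<Rightarrow> 'k" and S :: "'h \<Rightarrow> 'h"
    and sC :: "'k \<Rightarrow> 'c::ab_group_add \<Rightarrow> 'c"
    and \<Delta>C :: "'c \<Rightarrow> ('c, 'c, 'k) tensor" and \<epsilon>C :: "'c \<Rightarrow> 'k"
    and actC :: "'c \<Rightarrow> 'h \<Rightarrow> 'c"
    and sM :: "'k \<Rightarrow> 'm::ab_group_add \<Rightarrow> 'm"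
    and \<rho> :: "'m \<Rightarrow> ('m, 'c, 'k) tensor" and actM :: "'m \<Rightarrow> 'h \<Rightarrow> 'm" +
  fixes \<phi> :: "'c \<Rightarrow> 'h"
  assumes phi: "module_coalgebra_map sC \<Delta>C \<epsilon>C actC sH \<Delta>H \<epsilon>H (*) \<phi>"
begin

definition E :: "'m \<Rightarrow> 'm" where
  "E m = vlift sM (\<lambda>(m0, m1). actM m0 (S (\<phi> m1))) (\<rho> m)"

lemma phi_simps: "\<phi> (x + y) = \<phi> x + \<phi> y" "\<phi> (sC r x) = sH r (\<phi> x)"
  "\<epsilon>H (\<phi> x) = \<epsilon>C x" "\<phi> (actC x h) = \<phi> x * h"
  using phi by (simp_all add: module_coalgebra_map_def Vector_Spaces.linear_iff)

lemmas forms = bilform_def trilform_def linform_def sw_linear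
  sw_coaction sw_comult linear_to_tensor_simps[OF H.comult_linear]
  phi_simps act_simps C.act_simps H.antipode_simps H.counit_simps C.counit_simps
  H.scale_mult_left H.scale_mult_right distrib_left distrib_right

lemma sw_comult_phi:
  assumes "bilform sH sH f"
  shows "sw (\<Delta>H (\<phi> c)) f = sw (\<Delta>C c) (\<lambda>a b. f (\<phi> a) (\<phi> b))"
proof -
  have "\<Delta>H (\<phi> c) = tensor_map sH sH \<phi> \<phi> (\<Delta>C c)"
    using phi by (simp add: module_coalgebra_map_def)
  then show ?thesis
    using sw_tensor_map(2)[of "\<Delta>C c" sC sC sH sH \<phi> \<phi>, OF comult_in_qspace _ assms]
    by (simp add: bilform_def linform_def phi_simps)
qed

section \<open>Properties of the operator \<open>E\<close>\<close>

lemma form_E: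
  assumes "linform sM g"
  shows "g (E m) = sw (\<rho> m) (\<lambda>m0 m1. g (actM m0 (S (\<phi> m1))))"
  unfolding E_def
  by (rule sw_vlift[OF M.vector_space_axioms coaction_in_qspace _ assms]) (simp add: forms)

lemma E_linear: "E (m + n) = E m + E n" "E (sM r m) = sM r (E m)"
proof -
  show "E (m + n) = E m + E n"
  proof (rule linform_eqI[OF M.vector_space_axioms])
    fix g assume g: "linform sM g"
    show "g (E (m + n)) = g (E m + E n)"
      unfolding form_E[OF g] linformD(1)[OF g]
      by (rule sw_coaction) (simp add: forms linformD(1,2)[OF g])
  qed
  show "E (sM r m) = sM r (E m)"
  proof (rule linform_eqI[OF M.vector_space_axioms])
    fix g assume g: "linform sM g"
    show "g (E (sM r m)) = g (sM r (E m))"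
      unfolding form_E[OF g] linformD(2)[OF g]
      by (rule sw_coaction) (simp add: forms linformD(1,2)[OF g])
  qed
qed

text \<open>H-linearity of \<open>\<phi>\<close> and antimultiplicativity of \<open>S\<close> give
  S\<phi>(m_1 h_2) = S(h_2) S\<phi>(m_1). So h_1 meets S(h_2), and the two cancel to
  \<epsilon>(h).\<close>

lemma E_act: "E (actM m h) = sM (\<epsilon>H h) (E m)"
proof (rule linform_eqI[OF M.vector_space_axioms])
  fix g assume g: "linform sM g"
  note gs = linformD(1,2)[OF g]
  have "g (E (actM m h)) =
      sw (\<rho> m) (\<lambda>m0 m1. sw (\<Delta>H h) (\<lambda>h1 h2. g (actM (actM m0 h1) (S (\<phi> (actC m1 h2))))))"
    unfolding form_E[OF g] by (rule sw_coaction_act) (simp add: forms gs)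
  also have "\<dots> = sw (\<rho> m) (\<lambda>m0 m1. sw (\<Delta>H h) (\<lambda>h1 h2. g (actM m0 (h1 * S h2 * S (\<phi> m1)))))"
    by (simp add: phi_simps H.antipode_mult act_mult mult.assoc)
  also have "\<dots> = sw (\<rho> m) (\<lambda>m0 m1. \<epsilon>H h * g (actM m0 (1 * S (\<phi> m1))))"
    by (subst H.sw_antipode(2)) (simp_all add: forms gs)
  also have "\<dots> = g (sM (\<epsilon>H h) (E m))"
    by (simp add: form_E[OF g] gs sw_linear)
  finally show "g (E (actM m h)) = g (sM (\<epsilon>H h) (E m))" .
qed

lemma E_antipode_phi: "E (actM m (S (\<phi> c))) = sM (\<epsilon>C c) (E m)"
  by (simp add: E_act H.counit_antipode phi_simps)

text \<open>E(m_0 S\<phi>(m_1)) = \<epsilon>(m_1) E(m_0), and the counit law sums this to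
  E(m).\<close>

lemma E_idem: "E (E m) = E m"
proof (rule linform_eqI[OF M.vector_space_axioms])
  fix g assume g: "linform sM g"
  \<comment> \<open>\<open>form_E\<close> is applied to the form \<open>g\<close> after
    \<open>E\<close>, which moves the outer \<open>E\<close> inside the Sweedler sum.\<close>
  have gE: "linform sM (\<lambda>m. g (E m))" by (simp add: linform_def E_linear linformD[OF g])
  show "g (E (E m)) = g (E m)"
    unfolding form_E[OF gE] by (simp add: E_antipode_phi linformD[OF g] sw_coaction_counit[OF gE])
qed

lemma mapped_hopf_module_self:
  "mapped_hopf_module sH \<Delta>H \<epsilon>H S sC \<Delta>C \<epsilon>C actC sC \<Delta>C actC \<phi>"
  by (intro mapped_hopf_module.intro H.hopf_algebra_axioms C.relative_hopf_module_self
      mapped_hopf_module_axioms.intro phi)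

interpretation self: mapped_hopf_module sH \<Delta>H \<epsilon>H S sC \<Delta>C \<epsilon>C actC sC \<Delta>C actC \<phi>
  by (rule mapped_hopf_module_self)

text \<open>As \<open>S\<close> reverses coproducts, the coaction sends m_0 S\<phi>(m_1) to m_0
  S\<phi>(m_3) \<otimes> m_1 S\<phi>(m_2), with legs numbered on the right from one iterated
  coaction. The second factor is the operator of \<open>C\<close>.\<close>

lemma sw_coaction_E:
  assumes f: "bilform sM sC f"
  shows "sw (\<rho> (E m)) f =
    sw (\<rho> m) (\<lambda>m0 t. sw (\<Delta>C t) (\<lambda>c d. f (actM m0 (S (\<phi> d))) (self.E c)))"
proof -
  note fs = bilformD[OF f]
  have fE: "f n (self.E c) = sw (\<Delta>C c) (\<lambda>c1 a. f n (actC c1 (S (\<phi> a))))" for n c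
    by (rule self.form_E) (simp add: linform_def fs)
  \<comment> \<open>The crossing of \<open>a\<close> and \<open>b\<close> comes from the antipode;
    \<open>sw_comult_phi\<close> then replaces the legs of \<open>\<phi> c\<close> by images of the
    legs of \<open>c\<close>.\<close>
  have act: "sw (\<rho> (actM m0 (S (\<phi> c)))) f =
      sw (\<rho> m0) (\<lambda>n0 n1. sw (\<Delta>C c) (\<lambda>a b. f (actM n0 (S (\<phi> b))) (actC n1 (S (\<phi> a)))))" for m0 c
    by (subst sw_coaction_act[OF f], subst H.sw_comult_antipode, simp add: forms fs,
        subst sw_comult_phi, simp_all add: forms fs)
  \<comment> \<open>Coassociativity moves \<open>a\<close> next to \<open>n1\<close>, where the two
    assemble into \<open>self.E\<close>.\<close>
  have shift: "sw (\<Delta>C t) (\<lambda>n1 c. sw (\<Delta>C c) (\<lambda>a b. f (actM n0 (S (\<phi> b))) (actC n1 (S (\<phi> a))))) =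
      sw (\<Delta>C t) (\<lambda>c d. f (actM n0 (S (\<phi> d))) (self.E c))" for n0 t
    unfolding fE by (rule self.sw_coaction_coassoc[symmetric]) (simp add: forms fs)
  \<comment> \<open>\<open>form_E\<close> is used with the linear form that sends n to
    \<open>sw (\<rho> n) f\<close>.\<close>
  have "sw (\<rho> (E m)) f = sw (\<rho> m) (\<lambda>m0 c. sw (\<rho> (actM m0 (S (\<phi> c)))) f)"
    by (rule form_E) (simp add: linform_def sw_coaction f)
  also have "\<dots> = sw (\<rho> m) (\<lambda>n0 t. sw (\<Delta>C t)
      (\<lambda>n1 c. sw (\<Delta>C c) (\<lambda>a b. f (actM n0 (S (\<phi> b))) (actC n1 (S (\<phi> a))))))"
    unfolding act by (rule sw_coaction_coassoc) (simp add: forms fs)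
  finally show ?thesis by (simp only: shift)
qed

lemma rota_baxter_E:
  "rota_baxter_paired_comodule sC \<Delta>C \<epsilon>C sM \<rho> self.E E (- 1)"
proof (intro rota_baxter_paired_comodule.intro right_comodule_axioms
    rota_baxter_paired_comodule_axioms.intro)
  show "Vector_Spaces.linear sC sC self.E"
    by (simp add: Vector_Spaces.linear_iff coalgebra.axioms(1)[OF right_comodule.axioms(1)[OF right_comodule_axioms]] self.E_linear)
  show "Vector_Spaces.linear sM sM E"
    by (simp add: Vector_Spaces.linear_iff M.vector_space_axioms E_linear)
  fix m
  let ?N = "tensor_rel sM sC"
  note map_bil = bilform_def linform_def E_linear self.E_linear
  have map: "tensor_map sM sC E self.E X \<in> qspace ?N" "tensor_map sM sC id self.E X \<in> qspace ?N"
    "tensor_map sM sC E id X \<in> qspace ?N"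
    "bilform sM sC f \<Longrightarrow> sw (tensor_map sM sC E self.E X) f = sw X (\<lambda>a b. f (E a) (self.E b))"
    "bilform sM sC f \<Longrightarrow> sw (tensor_map sM sC id self.E X) f = sw X (\<lambda>a b. f a (self.E b))"
    "bilform sM sC f \<Longrightarrow> sw (tensor_map sM sC E id X) f = sw X (\<lambda>a b. f (E a) b)"
    if "X \<in> qspace ?N" for X f
    using sw_tensor_map[OF that, of sM sC E self.E] sw_tensor_map[OF that, of sM sC id self.E]
      sw_tensor_map[OF that, of sM sC E id]
    by (simp_all add: map_bil)
  show "tensor_map sM sC E self.E (\<rho> m) =
      qadd ?N (qadd ?N (tensor_map sM sC id self.E (\<rho> (E m))) (tensor_map sM sC E id (\<rho> (E m))))
        (qscale ?N (- 1) (\<rho> (E m)))"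
  proof (rule tensor_eqI[of _ sM sC])
    fix f assume f: "bilform sM sC f"
    note fs = bilformD[OF f]
    \<comment> \<open>The second leg is already a value of the idempotent \<open>self.E\<close>.
      This summand will cancel against the term of weight -1.\<close>
    have "sw (\<rho> (E m)) (\<lambda>a b. f a (self.E b)) = sw (\<rho> (E m)) f"
      by (subst (1 2) sw_coaction_E) (simp_all add: f self.E_idem map_bil fs)
    moreover have "sw (\<rho> (E m)) (\<lambda>a b. f (E a) b) = sw (\<rho> m) (\<lambda>a b. f (E a) (self.E b))"
    proof -
      \<comment> \<open>\<open>E\<close> turns the factor S\<phi>(d) on the first leg into
        \<epsilon>(d), and the counit law then absorbs \<open>d\<close>.\<close>
      have "sw (\<rho> (E m)) (\<lambda>a b. f (E a) b) =
          sw (\<rho> m) (\<lambda>m0 t. sw (\<Delta>C t) (\<lambda>c d. \<epsilon>C d * f (E m0) (self.E c)))"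
        by (subst sw_coaction_E) (simp_all add: map_bil fs E_antipode_phi)
      also have "\<dots> = sw (\<rho> m) (\<lambda>m0 t. f (E m0) (self.E t))"
        by (subst self.sw_coaction_counit) (simp_all add: map_bil fs)
      finally show ?thesis .
    qed
    ultimately show "sw (tensor_map sM sC E self.E (\<rho> m)) f =
        sw (qadd ?N (qadd ?N (tensor_map sM sC id self.E (\<rho> (E m))) (tensor_map sM sC E id (\<rho> (E m))))
          (qscale ?N (- 1) (\<rho> (E m)))) f"
      by (simp add: sw_qadd sw_qscale map f)
  qed (simp_all add: sw_qadd sw_qscale map)
qed

end

theorem proposition4p13:
  fixes sH :: "'k::field \<Rightarrow> 'h::ring_1 \<Rightarrow> 'h"
    and \<Delta>H :: "'h \<Rightarrow> ('h, 'h, 'k) tensor" and \<epsilon>H :: "'h \<Rightarrow> 'k" and S :: "'h \<Rightarrow> 'h"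
    and sC :: "'k \<Rightarrow> 'c::ab_group_add \<Rightarrow> 'c"
    and \<Delta>C :: "'c \<Rightarrow> ('c, 'c, 'k) tensor" and \<epsilon>C :: "'c \<Rightarrow> 'k"
    and actC :: "'c \<Rightarrow> 'h \<Rightarrow> 'c"
    and sM :: "'k \<Rightarrow> 'm::ab_group_add \<Rightarrow> 'm"
    and \<rho> :: "'m \<Rightarrow> ('m, 'c, 'k) tensor" and actM :: "'m \<Rightarrow> 'h \<Rightarrow> 'm"
    and \<phi> :: "'c \<Rightarrow> 'h"
    and E_C :: "'c \<Rightarrow> 'c" and E_M :: "'m \<Rightarrow> 'm"
  assumes "hopf_algebra sH \<Delta>H \<epsilon>H S"
    and "module_coalgebra sH \<Delta>H \<epsilon>H sC \<Delta>C \<epsilon>C actC"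
    and "relative_hopf_module sH \<Delta>H \<epsilon>H sC \<Delta>C \<epsilon>C actC sM \<rho> actM"
    and "module_coalgebra_map sC \<Delta>C \<epsilon>C actC sH \<Delta>H \<epsilon>H (*) \<phi>"
    and "\<And>c. E_C c = vlift sC (\<lambda>(c1, c2). actC c1 (S (\<phi> c2))) (\<Delta>C c)"
    and "\<And>m. E_M m = vlift sM (\<lambda>(m0, m1). actM m0 (S (\<phi> m1))) (\<rho> m)"
  shows "rota_baxter_paired_comodule sC \<Delta>C \<epsilon>C sM \<rho> E_C E_M (- 1)"
proof -
  interpret M: mapped_hopf_module sH \<Delta>H \<epsilon>H S sC \<Delta>C \<epsilon>C actC sM \<rho> actM \<phi>
    by (intro mapped_hopf_module.intro assms(1,3) mapped_hopf_module_axioms.intro assms(4))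
  interpret C: mapped_hopf_module sH \<Delta>H \<epsilon>H S sC \<Delta>C \<epsilon>C actC sC \<Delta>C actC \<phi>
    by (rule M.mapped_hopf_module_self)
  have "E_C = C.E" by (rule ext) (simp add: assms(5) C.E_def)
  moreover have "E_M = M.E" by (rule ext) (simp add: assms(6) M.E_def)
  ultimately show ?thesis using M.rota_baxter_E by simp
qed

end
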